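(* Let $q\in\mathbb{Q}\cap\mathbb{Z}_2$ and let $a,k,b,v\in\mathbb{N}$ with $a<2^k$, $b<2^v$ and $q=a+2^k\bar{b}_{v,\infty}$. Let $m=\alpha(b)$ and let $t$ be a positive integer. Then $$\Phi\left(a+2^k\bar{b}_{v,t}\right)=\Phi(q)-\frac{\Phi\left(\bar{b}_{v,\infty}\right)}{3^{mt+\alpha(a)}}2^{k+tv}.$$
   Context: $\mathbb{Z}_2$ is the ring of $2$-adic integers; $\mathbb{N}=\{0,1,2,\dots\}$. The map $\Phi:\mathbb{Z}_2\to\mathbb{Z}_2$ is defined as follows: if $x=\sum_i 2^{e_i}$ with $0\leq e_0<e_1<\cdots$ (finite or infinite sum; $x=0$ is the empty sum), then $\Phi(x)=-\sum_i 2^{e_i}3^{-i}$ ($\Phi(0)=0$). For $a\in\mathbb{N}$, $\alpha(a)$ is the number of ones in the binary expansion of $a$. For $b,v,t\in\mathbb{N}$, $\bar{b}_{v,t}=b\sum_{i=0}^{t-1}2^{vi}$ and $\bar{b}_{v,\infty}=b\sum_{i=0}^{\infty}2^{vi}$ (a $2$-adic integer). *)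

theory Defs
  imports Complex_Main "HOL-Library.Infinite_Set"
begin

text \<open>
  The ring of 2-adic integers, realised as the inverse limit of the rings
  \<open>\<int>/2\<^sup>n\<int>\<close>: \<open>res x n\<close> is the representative in \<open>{0..<2^n}\<close> of the residue class
  of \<open>x\<close> modulo \<open>2^n\<close>.
\<close>

typedef z2 = "{f :: nat \<Rightarrow> int. \<forall>n. f n = f (Suc n) mod 2 ^ n}"
  morphisms res Abs_z2
  by (rule exI[of _ "\<lambda>_. 0"]) simp

setup_lifting type_definition_z2

lemma mod_power_Suc_mod: "c mod 2 ^ Suc n mod 2 ^ n = c mod 2 ^ n" for c :: int
  by (simp add: mod_mod_cancel)

instantiation z2 :: comm_ring_1
begin

lift_definition zero_z2 :: z2 is "\<lambda>_. 0" by simp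

lift_definition one_z2 :: z2 is "\<lambda>n. 1 mod 2 ^ n"
  by (simp add: mod_mod_cancel)

lift_definition plus_z2 :: "z2 \<Rightarrow> z2 \<Rightarrow> z2" is "\<lambda>f g n. (f n + g n) mod 2 ^ n"
proof -
  fix f g :: "nat \<Rightarrow> int" and n
  assume "\<And>n. f n = f (Suc n) mod 2 ^ n" and "\<And>n. g n = g (Suc n) mod 2 ^ n"
  then show "(f n + g n) mod 2 ^ n = (f (Suc n) + g (Suc n)) mod 2 ^ Suc n mod 2 ^ n"
    unfolding mod_power_Suc_mod by (metis mod_add_eq)
qed

lift_definition minus_z2 :: "z2 \<Rightarrow> z2 \<Rightarrow> z2" is "\<lambda>f g n. (f n - g n) mod 2 ^ n"
proof -
  fix f g :: "nat \<Rightarrow> int" and n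
  assume "\<And>n. f n = f (Suc n) mod 2 ^ n" and "\<And>n. g n = g (Suc n) mod 2 ^ n"
  then show "(f n - g n) mod 2 ^ n = (f (Suc n) - g (Suc n)) mod 2 ^ Suc n mod 2 ^ n"
    unfolding mod_power_Suc_mod by (metis mod_diff_eq)
qed

lift_definition uminus_z2 :: "z2 \<Rightarrow> z2" is "\<lambda>f n. (- f n) mod 2 ^ n"
proof -
  fix f :: "nat \<Rightarrow> int" and n
  assume "\<And>n. f n = f (Suc n) mod 2 ^ n"
  then show "(- f n) mod 2 ^ n = (- f (Suc n)) mod 2 ^ Suc n mod 2 ^ n"
    unfolding mod_power_Suc_mod by (metis mod_minus_eq)
qed

lift_definition times_z2 :: "z2 \<Rightarrow> z2 \<Rightarrow> z2" is "\<lambda>f g n. (f n * g n) mod 2 ^ n"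
proof -
  fix f g :: "nat \<Rightarrow> int" and n
  assume "\<And>n. f n = f (Suc n) mod 2 ^ n" and "\<And>n. g n = g (Suc n) mod 2 ^ n"
  then show "(f n * g n) mod 2 ^ n = (f (Suc n) * g (Suc n)) mod 2 ^ Suc n mod 2 ^ n"
    unfolding mod_power_Suc_mod by (metis mod_mult_eq)
qed

lemma res_0 [simp]: "res 0 n = 0"
  by (simp add: zero_z2.rep_eq)

lemma res_1: "res 1 n = 1 mod 2 ^ n"
  by (simp add: one_z2.rep_eq)

lemma res_add: "res (x + y) n = (res x n + res y n) mod 2 ^ n"
  by (simp add: plus_z2.rep_eq)

lemma res_diff: "res (x - y) n = (res x n - res y n) mod 2 ^ n"
  by (simp add: minus_z2.rep_eq)

lemma res_uminus: "res (- x) n = (- res x n) mod 2 ^ n"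
  by (simp add: uminus_z2.rep_eq)

lemma res_mult: "res (x * y) n = (res x n * res y n) mod 2 ^ n"
  by (simp add: times_z2.rep_eq)

lemma res_Suc_mod: "res x (Suc n) mod 2 ^ n = res x n"
  using res[of x] by (metis (mono_tags, lifting) mem_Collect_eq)

lemma res_mod [simp]: "res x n mod 2 ^ n = res x n"
  by (metis mod_mod_trivial res_Suc_mod)

lemma res_nonneg [simp]: "0 \<le> res x n"
  by (metis pos_mod_sign res_mod zero_less_numeral zero_less_power)

lemma res_less [simp]: "res x n < 2 ^ n"
  by (metis pos_mod_bound res_mod zero_less_numeral zero_less_power)

lemma res_at_0 [simp]: "res x 0 = 0"
  using res_mod[of x 0] by simp

lemma z2_eqI: "(\<And>n. res x n = res y n) \<Longrightarrow> x = y"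
  by (metis ext res_inject)

instance
proof
  fix a b c :: z2
  show "a + b + c = a + (b + c)"
    by (rule z2_eqI) (simp add: res_add mod_simps add.assoc)
  show "a + b = b + a"
    by (rule z2_eqI) (simp add: res_add add.commute)
  show "0 + a = a"
    by (rule z2_eqI) (simp add: res_add)
  show "- a + a = 0"
    by (rule z2_eqI) (simp add: res_add res_uminus mod_simps)
  show "a - b = a + - b"
    by (rule z2_eqI) (simp add: res_add res_diff res_uminus mod_simps)
  show "a * b * c = a * (b * c)"
    by (rule z2_eqI) (simp add: res_mult mod_simps mult.assoc)
  show "a * b = b * a"
    by (rule z2_eqI) (simp add: res_mult mult.commute)
  show "1 * a = a"
    by (rule z2_eqI) (metis mod_mult_left_eq mult_1 res_1 res_mod res_mult)
  show "(a + b) * c = a * c + b * c"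
    by (rule z2_eqI) (simp add: res_add res_mult mod_simps distrib_right)
  show "(0::z2) \<noteq> 1"
  proof
    assume "(0::z2) = 1"
    then have "res 0 1 = res 1 1" by simp
    then show False by (simp add: res_1)
  qed
qed

end

lemma res_mod_le: "m \<le> n \<Longrightarrow> res x n mod 2 ^ m = res x m"
proof (induction n rule: dec_induct)
  case (step n)
  then show ?case
    by (metis le_imp_power_dvd mod_mod_cancel res_Suc_mod)
qed simp

lemma res_of_nat: "res (of_nat k) n = int k mod 2 ^ n"
  by (induction k) (auto simp: res_add res_1 mod_simps)

lemma res_of_int: "res (of_int k) n = k mod 2 ^ n"
  by (cases k rule: int_cases2) (auto simp: res_of_nat res_uminus mod_simps)

lemma res_diff_eq_0_iff: "res (x - y) n = 0 \<longleftrightarrow> res x n = res y n"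
  by (metis cancel_comm_monoid_add_class.diff_cancel diff_self mod_0 mod_eq_dvd_iff mod_0_imp_dvd
      res_diff res_mod)

text \<open>
  The usual 2-adic absolute value; the exponent is the 2-adic valuation, since
  \<open>res x (Suc n) \<noteq> 0\<close> says that \<open>x\<close> is not divisible by \<open>2 ^ Suc n\<close>.
\<close>

definition abs_2adic :: "z2 \<Rightarrow> real" where
  "abs_2adic x = (if x = 0 then 0 else (1 / 2) ^ (LEAST n. res x (Suc n) \<noteq> 0))"

lemma abs_2adic_le_iff: "abs_2adic x \<le> (1 / 2) ^ n \<longleftrightarrow> res x n = 0"
proof (cases "x = 0")
  case False
  define v where "v = (LEAST n. res x (Suc n) \<noteq> 0)"
  from False obtain m where m: "res x m \<noteq> 0"
    using z2_eqI[of x 0] by auto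
  then have "\<exists>n. res x (Suc n) \<noteq> 0"
    by (metis not0_implies_Suc res_at_0)
  then have v: "res x (Suc v) \<noteq> 0"
    unfolding v_def by (rule LeastI_ex)
  have v': "res x v = 0"
  proof (cases v)
    case (Suc w)
    then have "\<not> res x (Suc w) \<noteq> 0"
      unfolding v_def by (metis lessI not_less_Least)
    then show ?thesis using Suc by simp
  qed simp
  have "abs_2adic x \<le> (1 / 2) ^ n \<longleftrightarrow> n \<le> v"
    using False by (simp add: abs_2adic_def v_def[symmetric] power_decreasing_iff)
  also have "\<dots> \<longleftrightarrow> res x n = 0"
    using v v' by (metis mod_0 not_less_eq_eq res_mod_le)
  finally show ?thesis .
qed (simp add: abs_2adic_def)

lemma abs_2adic_nonneg: "0 \<le> abs_2adic x"
  by (simp add: abs_2adic_def)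

lemma abs_2adic_cases: "x = 0 \<or> (\<exists>n. abs_2adic x = (1 / 2) ^ n)"
  by (auto simp: abs_2adic_def)

lemma abs_2adic_minus_commute: "abs_2adic (x - y) = abs_2adic (y - x)"
proof -
  have "res (x - y) n = 0 \<longleftrightarrow> res (y - x) n = 0" for n
    by (auto simp: res_diff_eq_0_iff)
  then show ?thesis
    by (simp add: abs_2adic_def)
qed

lemma abs_2adic_add_le: "abs_2adic (x + y) \<le> max (abs_2adic x) (abs_2adic y)"
proof -
  have *: "abs_2adic (x + y) \<le> (1 / 2) ^ n"
    if "abs_2adic x \<le> (1 / 2) ^ n" "abs_2adic y \<le> (1 / 2) ^ n" for n
    using that by (simp add: abs_2adic_le_iff res_add)
  show ?thesis
  proof (cases "x = 0 \<or> y = 0")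
    case False
    then obtain m n where "abs_2adic x = (1 / 2) ^ m" "abs_2adic y = (1 / 2) ^ n"
      using abs_2adic_cases by meson
    then show ?thesis
      using *[of m] *[of n] by (cases "abs_2adic x \<le> abs_2adic y") auto
  qed (auto simp: max_def abs_2adic_def)
qed

instantiation z2 :: metric_space
begin

definition dist_z2 :: "z2 \<Rightarrow> z2 \<Rightarrow> real" where
  "dist_z2 x y = abs_2adic (x - y)"

definition uniformity_z2 :: "(z2 \<times> z2) filter" where
  "uniformity_z2 = (INF e\<in>{0<..}. principal {(x, y). dist x y < e})"

definition open_z2 :: "z2 set \<Rightarrow> bool" where
  "open_z2 U \<longleftrightarrow> (\<forall>x\<in>U. eventually (\<lambda>(x', y). x' = x \<longrightarrow> y \<in> U) uniformity)"

instance
proof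
  fix x y z :: z2
  show "dist x y = 0 \<longleftrightarrow> x = y"
    by (auto simp: dist_z2_def abs_2adic_def)
  have "abs_2adic (x - y) = abs_2adic ((x - z) + (z - y))"
    by simp
  also have "\<dots> \<le> max (abs_2adic (x - z)) (abs_2adic (z - y))"
    by (rule abs_2adic_add_le)
  also have "\<dots> \<le> abs_2adic (x - z) + abs_2adic (y - z)"
    using abs_2adic_nonneg[of "x - z"] abs_2adic_nonneg[of "z - y"]
      abs_2adic_minus_commute[of y z] by simp
  finally show "dist x y \<le> dist x z + dist y z"
    by (simp add: dist_z2_def)
qed (simp_all add: uniformity_z2_def open_z2_def)

end

lemma dist_z2_le_iff: "dist x y \<le> (1 / 2) ^ n \<longleftrightarrow> res x n = res y n"
  by (simp add: dist_z2_def abs_2adic_le_iff res_diff_eq_0_iff)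

lemma tendsto_z2_iff:
  "(f \<longlongrightarrow> x) F \<longleftrightarrow> (\<forall>n. eventually (\<lambda>i. res (f i) n = res x n) F)" for x :: z2
proof
  assume lim: "(f \<longlongrightarrow> x) F"
  show "\<forall>n. eventually (\<lambda>i. res (f i) n = res x n) F"
  proof
    fix n
    have "eventually (\<lambda>i. dist (f i) x < (1 / 2) ^ n) F"
      using lim by (rule tendstoD) simp
    then show "eventually (\<lambda>i. res (f i) n = res x n) F"
      by eventually_elim (simp add: dist_z2_le_iff[symmetric])
  qed
next
  assume ev: "\<forall>n. eventually (\<lambda>i. res (f i) n = res x n) F"
  show "(f \<longlongrightarrow> x) F"
  proof (rule tendstoI)
    fix e :: real
    assume "e > 0"
    then obtain n where n: "(1 / 2) ^ n < e"
      using real_arch_pow_inv[of e "1 / 2"] by auto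
    have "eventually (\<lambda>i. res (f i) n = res x n) F"
      using ev by blast
    then show "eventually (\<lambda>i. dist (f i) x < e) F"
      by eventually_elim (use n in \<open>simp add: dist_z2_le_iff[symmetric]\<close>)
  qed
qed

text \<open>Inverses of units; as usual, \<open>inverse\<close> is \<open>0\<close> outside its domain.\<close>

instantiation z2 :: inverse
begin

definition inverse_z2 :: "z2 \<Rightarrow> z2" where
  "inverse_z2 x = (if x dvd 1 then THE y. x * y = 1 else 0)"

definition divide_z2 :: "z2 \<Rightarrow> z2 \<Rightarrow> z2" where
  "divide_z2 x y = x * inverse y"

instance ..

end

lemma z2_inverse_eqI:
  fixes x y :: z2
  assumes "x * y = 1"
  shows "inverse x = y"
proof -
  have "z = y" if "x * z = 1" for z
    by (metis assms that mult.assoc mult.commute mult_1)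
  then have "(THE y. x * y = 1) = y"
    using assms by blast
  moreover have "x dvd 1"
    using assms by (metis dvdI)
  ultimately show ?thesis
    by (simp add: inverse_z2_def)
qed

lemma z2_three_inverse: "(3::z2) * inverse 3 = 1"
proof -
  define f :: "nat \<Rightarrow> int" where "f n = (\<Sum>i<n. (- 2) ^ i) mod 2 ^ n" for n
  have "f n = f (Suc n) mod 2 ^ n" for n
  proof -
    have "f (Suc n) mod 2 ^ n = ((\<Sum>i<n. (- 2) ^ i) + (- 2) ^ n) mod 2 ^ n"
      by (simp add: f_def mod_mod_cancel)
    also have "(2::int) ^ n dvd (- 2) ^ n"
      by (simp add: dvd_power_same)
    then have "((\<Sum>i<n. (- 2) ^ i) + (- 2) ^ n) mod 2 ^ n = (\<Sum>i<n. (- 2) ^ i) mod (2::int) ^ n"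
      by (metis add.right_neutral dvd_imp_mod_0 mod_add_right_eq)
    finally show ?thesis by (simp add: f_def)
  qed
  then have res_f: "res (Abs_z2 f) = f"
    by (intro Abs_z2_inverse CollectI allI)
  have "3 * Abs_z2 f = 1"
  proof (rule z2_eqI)
    fix n
    have "3 * (\<Sum>i<n. (- 2) ^ i) = 1 - (- 2 :: int) ^ n"
      using one_diff_power_eq[of "- 2 :: int" n] by simp
    moreover have "(2::int) ^ n dvd (- 2) ^ n"
      by (simp add: dvd_power_same)
    ultimately have "(3 * (\<Sum>i<n. (- 2) ^ i)) mod 2 ^ n = (1::int) mod 2 ^ n"
      by (metis diff_zero dvd_imp_mod_0 mod_diff_right_eq)
    moreover have "res (3 * Abs_z2 f) n = (3 * (\<Sum>i<n. (- 2) ^ i)) mod 2 ^ n"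
      using res_of_int[of 3 n] by (simp add: res_mult res_f f_def mod_simps)
    ultimately show "res (3 * Abs_z2 f) n = res 1 n"
      by (simp add: res_1)
  qed
  then show ?thesis
    by (metis z2_inverse_eqI)
qed

text \<open>
  \<open>\<rat> \<inter> \<int>\<^sub>2\<close>, without leaving \<open>\<int>\<^sub>2\<close>: the 2-adic integers \<open>x\<close> equal to \<open>n / m\<close>
  (in \<open>\<rat>\<^sub>2\<close>) for some integers \<open>n\<close> and \<open>m \<noteq> 0\<close>.
\<close>

definition rationals_z2 :: "z2 set" where
  "rationals_z2 = {x. \<exists>m n :: int. m \<noteq> 0 \<and> of_int m * x = of_int n}"

definition exponents :: "z2 \<Rightarrow> nat set" where
  "exponents x = (THE E. (\<lambda>n. if n \<in> E then 2 ^ n else 0) sums x)"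

text \<open>
  If \<open>x = (\<Sum>i. 2 ^ e i)\<close> with \<open>e 0 < e 1 < \<dots>\<close> (finite or infinite), then
  \<open>exponents x\<close> is the set of the \<open>e i\<close>, and \<open>enumerate (exponents x) i\<close> is \<open>e i\<close>; for a
  finite set \<open>E\<close>, \<open>enumerate E i\<close> is meaningful only for \<open>i < card E\<close>.
\<close>

definition Phi :: "z2 \<Rightarrow> z2" where
  "Phi x = (let E = exponents x in
     - (if finite E then \<Sum>i<card E. 2 ^ enumerate E i * inverse 3 ^ i
        else \<Sum>i. 2 ^ enumerate E i * inverse 3 ^ i))"

definition binary_ones :: "nat \<Rightarrow> nat" where
  "binary_ones a = card {i. bit a i}"

definition repeat_block :: "nat \<Rightarrow> nat \<Rightarrow> nat \<Rightarrow> nat" where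
  "repeat_block b v t = b * (\<Sum>i<t. 2 ^ (v * i))"

text \<open>
  For \<open>v = 0\<close> the series diverges; the constraint \<open>b < 2 ^ v\<close> then forces \<open>b = 0\<close>, and the
  product is \<open>0\<close> whatever \<open>suminf\<close> returns.
\<close>

definition repeat_block_inf :: "nat \<Rightarrow> nat \<Rightarrow> z2" where
  "repeat_block_inf b v = of_nat b * (\<Sum>i. 2 ^ (v * i))"

lemma res_sum_exponents:
  "res (\<Sum>i<N. if i \<in> E then 2 ^ i else 0) n = (\<Sum>i<N. if i \<in> E then 2 ^ i else 0) mod 2 ^ n"
proof -
  have "(\<Sum>i<N. if i \<in> E then 2 ^ i else 0) = (of_int (\<Sum>i<N. if i \<in> E then 2 ^ i else 0) :: z2)"
    by (simp add: if_distrib cong: if_cong)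
  then show ?thesis
    by (simp only: res_of_int)
qed

lemma mod_add_dvd: "m dvd c \<Longrightarrow> (a + c) mod m = a mod m" for a c m :: int
  by (auto elim: dvdE)

lemma sum_exponents_mod:
  fixes E :: "nat set"
  assumes "n \<le> N"
  shows "(\<Sum>i<N. if i \<in> E then 2 ^ i else 0) mod 2 ^ n = (\<Sum>i<n. if i \<in> E then 2 ^ i else (0::int))"
proof -
  have less: "(\<Sum>i<n. if i \<in> E then 2 ^ i else (0::int)) < 2 ^ n" for n
  proof (induction n)
    case (Suc n)
    moreover have "(if n \<in> E then 2 ^ n else (0::int)) \<le> 2 ^ n"
      by simp
    ultimately show ?case
      unfolding sum.lessThan_Suc power_Suc by linarith
  qed simp
  have nonneg: "0 \<le> (\<Sum>i<n. if i \<in> E then 2 ^ i else (0::int))"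
    by (rule sum_nonneg) simp
  show ?thesis
    using assms
  proof (induction N rule: dec_induct)
    case base
    then show ?case using less nonneg by simp
  next
    case (step N)
    have "(2::int) ^ n dvd (if N \<in> E then 2 ^ N else 0)"
      using step by (simp add: le_imp_power_dvd)
    from mod_add_dvd[OF this] show ?case
      unfolding sum.lessThan_Suc step.IH[symmetric] .
  qed
qed

lemma sums_exponents_iff:
  "(\<lambda>i. if i \<in> E then 2 ^ i else 0) sums x \<longleftrightarrow>
     (\<forall>n. res x n = (\<Sum>i<n. if i \<in> E then 2 ^ i else 0))"
proof -
  have "(\<lambda>i. if i \<in> E then 2 ^ i else 0) sums x \<longleftrightarrow>
    (\<forall>n. eventually (\<lambda>N. (\<Sum>i<N. if i \<in> E then 2 ^ i else 0) mod 2 ^ n = res x n) sequentially)"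
    by (simp add: sums_def tendsto_z2_iff res_sum_exponents)
  also have "\<dots> \<longleftrightarrow> (\<forall>n. eventually (\<lambda>N::nat. (\<Sum>i<n. if i \<in> E then 2 ^ i else 0) = res x n) sequentially)"
  proof (intro all_cong1 eventually_subst)
    fix n
    show "eventually (\<lambda>N. ((\<Sum>i<N. if i \<in> E then 2 ^ i else 0) mod 2 ^ n = res x n) =
       ((\<Sum>i<n. if i \<in> E then 2 ^ i else 0) = res x n)) sequentially"
      using eventually_ge_at_top[of n] by eventually_elim (simp add: sum_exponents_mod)
  qed
  finally show ?thesis
    by (auto simp: eq_commute)
qed

lemma ex1_exponents: "\<exists>!E. (\<lambda>i. if i \<in> E then 2 ^ i else 0) sums (x :: z2)"
proof (rule ex_ex1I)
  define E where "E = {i. res x (Suc i) \<noteq> res x i}"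
  have "res x n = (\<Sum>i<n. if i \<in> E then 2 ^ i else 0)" for n
  proof (induction n)
    case 0
    show ?case
      by simp
  next
    case (Suc n)
    have eq: "res x (Suc n) = res x n + 2 ^ n * (res x (Suc n) div 2 ^ n)"
      by (metis add.commute mult_div_mod_eq res_Suc_mod)
    have "0 \<le> res x (Suc n) div 2 ^ n"
      by (simp add: pos_imp_zdiv_nonneg_iff)
    moreover have "res x (Suc n) div 2 ^ n < 2"
    proof -
      have "2 ^ n * (res x (Suc n) div 2 ^ n) < 2 ^ n * 2"
        using res_less[of x "Suc n"] res_nonneg[of x n] eq
        unfolding power_Suc by linarith
      then show ?thesis by simp
    qed
    ultimately have "res x (Suc n) div 2 ^ n = 0 \<or> res x (Suc n) div 2 ^ n = 1"
      by linarith
    then have "res x (Suc n) = res x n + (if n \<in> E then 2 ^ n else 0)"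
      using eq unfolding E_def by fastforce
    then show ?case
      using Suc by simp
  qed
  then show "\<exists>E. (\<lambda>i. if i \<in> E then 2 ^ i else 0) sums x"
    using sums_exponents_iff by blast
next
  fix E F
  assume *: "(\<lambda>i. if i \<in> E then 2 ^ i else 0) sums x" "(\<lambda>i. if i \<in> F then 2 ^ i else 0) sums x"
  have "i \<in> E \<longleftrightarrow> i \<in> F" for i
  proof -
    have "(if i \<in> E then 2 ^ i else 0) = res x (Suc i) - res x i"
      using *(1) by (simp add: sums_exponents_iff)
    moreover have "(if i \<in> F then 2 ^ i else 0) = res x (Suc i) - res x i"
      using *(2) by (simp add: sums_exponents_iff)
    ultimately show ?thesis
      by (metis power_not_zero zero_neq_numeral)
  qed
  then show "E = F" by blast
qed

lemma exponents_sums: "(\<lambda>i. if i \<in> exponents x then 2 ^ i else 0) sums x"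
  unfolding exponents_def by (rule theI') (rule ex1_exponents)

lemma exponents_eqI:
  "(\<lambda>i. if i \<in> E then 2 ^ i else 0) sums x \<Longrightarrow> exponents x = E"
  using ex1_exponents exponents_sums by blast

text \<open>
  A series of 2-adic integers converges as soon as its terms tend to \<open>0\<close>; in particular the
  series defining \<open>Phi\<close> and \<open>repeat_block_inf\<close> (for \<open>v > 0\<close>) converge.
\<close>

lemma summable_z2:
  fixes f :: "nat \<Rightarrow> z2"
  assumes "f \<longlonglongrightarrow> 0"
  shows "summable f"
proof -
  have "\<exists>r. eventually (\<lambda>N. res (\<Sum>i<N. f i) n = r) sequentially" for n
  proof -
    have "eventually (\<lambda>i. res (f i) n = 0) sequentially"
      using assms by (simp add: tendsto_z2_iff)
    then obtain M where M: "\<And>i. i \<ge> M \<Longrightarrow> res (f i) n = 0"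
      unfolding eventually_sequentially by blast
    have "res (\<Sum>i<N. f i) n = res (\<Sum>i<M. f i) n" if "N \<ge> M" for N
      using that
    proof (induction N rule: dec_induct)
      case (step N)
      then show ?case using M[of N] by (simp add: res_add)
    qed simp
    then show ?thesis
      unfolding eventually_sequentially by blast
  qed
  then obtain g where g: "\<And>n. eventually (\<lambda>N. res (\<Sum>i<N. f i) n = g n) sequentially"
    by metis
  have "g n = g (Suc n) mod 2 ^ n" for n
  proof -
    have "eventually (\<lambda>N. res (\<Sum>i<N. f i) n = g n \<and> res (\<Sum>i<N. f i) (Suc n) = g (Suc n))
      sequentially"
      using g by (simp add: eventually_conj_iff)
    then obtain N where "res (\<Sum>i<N. f i) n = g n" "res (\<Sum>i<N. f i) (Suc n) = g (Suc n)"
      unfolding eventually_sequentially by blast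
    then show ?thesis
      by (metis res_Suc_mod)
  qed
  then have "res (Abs_z2 g) = g"
    by (intro Abs_z2_inverse CollectI allI)
  then have "f sums Abs_z2 g"
    using g by (simp add: sums_def tendsto_z2_iff)
  then show ?thesis
    by (rule sums_summable)
qed

lemma summable_z2_powers:
  fixes c :: "nat \<Rightarrow> z2"
  assumes "strict_mono e"
  shows "summable (\<lambda>i. 2 ^ e i * c i)"
proof (rule summable_z2, unfold tendsto_z2_iff, rule allI)
  fix n
  have "res (2 ^ e i * c i) n = res 0 n" if "i \<ge> n" for i
  proof -
    have "n \<le> e i"
      using that strict_mono_imp_increasing[OF assms, of i] by linarith
    then have "(2::int) ^ e i mod 2 ^ n = 0"
      by (simp add: le_imp_power_dvd)
    moreover have "res (2 ^ e i) n = 2 ^ e i mod 2 ^ n"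
      using res_of_int[of "2 ^ e i" n] by simp
    ultimately show ?thesis
      by (simp add: res_mult)
  qed
  then show "eventually (\<lambda>i. res (2 ^ e i * c i) n = res 0 n) sequentially"
    unfolding eventually_sequentially by blast
qed

end

theory Submission
  imports Defs
begin

text \<open>
  Reading off one binary digit gives \<open>Phi (2 * y) = 2 * Phi y\<close> and
  \<open>Phi (1 + 2 * y) = - 1 + 2 * Phi y / 3\<close>. Iterating over the \<open>k\<close> digits of \<open>a < 2 ^ k\<close>,
  \<open>Phi (a + 2 ^ k * y) = Phi a + 2 ^ k * Phi y / 3 ^ binary_ones a\<close>. The theorem is this identity
  for the truncation \<open>a + 2 ^ k * repeat_block b v t\<close> of \<open>q\<close>, whose remaining digits are again
  those of \<open>repeat_block_inf b v\<close>.
\<close>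

section \<open>Limits and series of 2-adic integers\<close>

lemma tendsto_z2_affine:
  fixes c d x :: z2
  assumes "(f \<longlongrightarrow> x) F"
  shows "((\<lambda>i. c + d * f i) \<longlongrightarrow> c + d * x) F"
  unfolding tendsto_z2_iff
proof
  fix n
  have "eventually (\<lambda>i. res (f i) n = res x n) F"
    using assms by (simp add: tendsto_z2_iff)
  \<comment> \<open>The residue of \<open>c + d * y\<close> modulo \<open>2 ^ n\<close> depends only
    on that of \<open>y\<close>.\<close>
  then show "eventually (\<lambda>i. res (c + d * f i) n = res (c + d * x) n) F"
    by eventually_elim (simp add: res_add res_mult)
qed

lemma sums_z2_mult:
  fixes d s :: z2
  assumes "f sums s"
  shows "(\<lambda>i. d * f i) sums (d * s)"
  using tendsto_z2_affine[OF assms[unfolded sums_def], of 0 d]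
  by (simp add: sums_def sum_distrib_left)

text \<open>Summation rule for a series whose tail is a scaled copy of another. It serves binary
  expansions, the series of \<open>Phi\<close> and, with \<open>g = f\<close>, geometric
  series.\<close>

lemma sums_z2_shift:
  fixes d s :: z2
  assumes "f sums s" and "\<And>i. g (Suc i) = d * f i"
  shows "g sums (g 0 + d * s)"
proof -
  have "(\<lambda>n. \<Sum>i<Suc n. g i) \<longlonglongrightarrow> g 0 + d * s"
    using tendsto_z2_affine[OF assms(1)[unfolded sums_def], of "g 0" d]
    by (simp add: sum.lessThan_Suc_shift assms(2) sum_distrib_left del: sum.lessThan_Suc)
  then show ?thesis
    unfolding sums_def by (subst (asm) filterlim_sequentially_Suc)
qed

section \<open>Exponents and \<open>Phi\<close> when one binary digit is prepended\<close>

lemma exponents_0 [simp]: "exponents 0 = {}"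
  by (rule exponents_eqI) simp

lemma Phi_0 [simp]: "Phi 0 = 0"
  by (simp add: Phi_def)

lemma exponents_double: "exponents (2 * y) = Suc ` exponents y"
proof (rule exponents_eqI)
  let ?g = "\<lambda>i. if i \<in> Suc ` exponents y then 2 ^ i else 0 :: z2"
  \<comment> \<open>Here \<open>?g 0 = 0\<close>, since \<open>0\<close> is not a successor;
    uniqueness of binary expansions then identifies the exponents.\<close>
  have "?g sums (?g 0 + 2 * y)"
    by (rule sums_z2_shift[OF exponents_sums]) auto
  then show "?g sums (2 * y)"
    by simp
qed

lemma exponents_double_add_one: "exponents (1 + 2 * y) = insert 0 (Suc ` exponents y)"
proof (rule exponents_eqI)
  let ?g = "\<lambda>i. if i \<in> insert 0 (Suc ` exponents y) then 2 ^ i else 0 :: z2"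
  have "?g sums (?g 0 + 2 * y)"
    by (rule sums_z2_shift[OF exponents_sums]) auto
  then show "?g sums (1 + 2 * y)"
    by simp
qed

lemma Least_image_Suc:
  assumes "E \<noteq> {}"
  shows "(LEAST n. n \<in> Suc ` E) = Suc (LEAST n. n \<in> E)"
proof (rule Least_equality)
  show "Suc (LEAST n. n \<in> E) \<in> Suc ` E"
    using assms by (metis LeastI all_not_in_conv imageI)
qed (auto intro: Least_le)

text \<open>\<open>Suc\<close> preserves order, so it commutes with removing least elements. The
  bound on \<open>i\<close> keeps \<open>enumerate\<close> from taking the least element of an empty
  set.\<close>

lemma enumerate_image_Suc:
  assumes "infinite E \<or> i < card E"
  shows "enumerate (Suc ` E) i = Suc (enumerate E i)"
  using assms
proof (induction i arbitrary: E)
  case 0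
  then have "E \<noteq> {}" by auto
  then show ?case
    unfolding enumerate_0 by (rule Least_image_Suc)
next
  case (Suc i)
  define l where "l = (LEAST n. n \<in> E)"
  have ne: "E \<noteq> {}" using Suc.prems by auto
  then have l: "l \<in> E"
    unfolding l_def by (metis LeastI all_not_in_conv)
  have "Suc ` E - {Suc l} = Suc ` (E - {l})"
    by auto
  moreover have "infinite (E - {l}) \<or> i < card (E - {l})"
    using Suc.prems l by (auto simp: card_Diff_singleton)
  ultimately show ?case
    using Suc.IH by (simp only: enumerate_Suc Least_image_Suc[OF ne] l_def[symmetric])
qed

lemma enumerate_insert_0_0: "enumerate (insert (0::nat) E) 0 = 0"
  unfolding enumerate_0 by (rule Least_equality) auto

lemma enumerate_insert_0_Suc:
  "enumerate (insert 0 (Suc ` E)) (Suc i) = enumerate (Suc ` E) i"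
proof -
  have "(LEAST n. n \<in> insert 0 (Suc ` E)) = 0"
    by (rule Least_equality) auto
  moreover have "insert 0 (Suc ` E) - {0} = Suc ` E"
    by auto
  ultimately show ?thesis
    by (simp only: enumerate_Suc)
qed

lemma Phi_finite:
  "finite (exponents x) \<Longrightarrow>
    Phi x = - (\<Sum>i<card (exponents x). 2 ^ enumerate (exponents x) i * inverse 3 ^ i)"
  by (simp add: Phi_def Let_def)

text \<open>Strictly increasing exponents make the terms tend to \<open>0\<close>, so the
  \<open>suminf\<close> in \<open>Phi\<close> is a genuine limit.\<close>

lemma Phi_infinite_sums:
  assumes "infinite (exponents x)"
  shows "(\<lambda>i. 2 ^ enumerate (exponents x) i * inverse 3 ^ i) sums (- Phi x)"
proof -
  have "strict_mono (enumerate (exponents x))"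
    using assms by (simp add: strict_mono_enumerate)
  then show ?thesis
    using assms by (simp add: Phi_def Let_def summable_sums summable_z2_powers)
qed

lemma Phi_eqI_infinite:
  assumes "infinite (exponents x)"
    and "(\<lambda>i. 2 ^ enumerate (exponents x) i * inverse 3 ^ i) sums (- s)"
  shows "Phi x = s"
  using sums_unique2[OF Phi_infinite_sums[OF assms(1)] assms(2)] by simp

text \<open>Every exponent grows by one but keeps its index, so only a factor 2 appears.\<close>

lemma Phi_double: "Phi (2 * y) = 2 * Phi y"
proof (cases "finite (exponents y)")
  case True
  then show ?thesis
    by (simp add: Phi_finite exponents_double card_image enumerate_image_Suc
        sum_distrib_left mult.assoc)
next
  case False
  then have inf: "infinite (exponents (2 * y))"
    by (simp add: exponents_double finite_image_iff)
  show ?thesis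
    by (rule Phi_eqI_infinite[OF inf])
      (use sums_z2_mult[OF Phi_infinite_sums[OF False], of 2] False
        in \<open>simp add: exponents_double enumerate_image_Suc mult.assoc\<close>)
qed

text \<open>The new exponent \<open>0\<close> takes index \<open>0\<close> and contributes
  \<open>- 1\<close>. Each old exponent grows by one and so does its index, whence the factor
  2/3.\<close>

lemma Phi_double_add_one: "Phi (1 + 2 * y) = - 1 + 2 * inverse 3 * Phi y"
proof (cases "finite (exponents y)")
  case True
  let ?E = "insert 0 (Suc ` exponents y)"
  have "(\<Sum>i<card ?E. 2 ^ enumerate ?E i * inverse 3 ^ i) =
    1 + (\<Sum>i<card (exponents y). 2 * inverse 3 * (2 ^ enumerate (exponents y) i * inverse 3 ^ i) :: z2)"
    using True
    by (simp add: card_image sum.lessThan_Suc_shift enumerate_insert_0_0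
        enumerate_insert_0_Suc enumerate_image_Suc mult_ac del: sum.lessThan_Suc)
  then show ?thesis
    using True
    by (simp add: Phi_finite exponents_double_add_one sum_distrib_left)
next
  case False
  let ?g = "\<lambda>i. 2 ^ enumerate (insert 0 (Suc ` exponents y)) i * inverse 3 ^ i :: z2"
  have inf: "infinite (exponents (1 + 2 * y))"
    using False by (simp add: exponents_double_add_one finite_image_iff)
  have "?g sums (?g 0 + 2 * inverse 3 * - Phi y)"
    by (rule sums_z2_shift[OF Phi_infinite_sums[OF False]])
      (use False in \<open>simp add: enumerate_insert_0_Suc enumerate_image_Suc mult_ac\<close>)
  then have "?g sums - (- 1 + 2 * inverse 3 * Phi y)"
    by (simp add: enumerate_insert_0_0)
  then show ?thesis
    by (intro Phi_eqI_infinite[OF inf]) (simp only: exponents_double_add_one)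
qed

section \<open>Counting ones, and prepending \<open>k\<close> digits at once\<close>

lemma binary_ones_0 [simp]: "binary_ones 0 = 0"
  by (simp add: binary_ones_def)

lemma finite_bits_nat: "finite {i. bit (n::nat) i}"
proof (rule finite_subset)
  show "{i. bit n i} \<subseteq> {..<n}"
  proof
    fix i assume "i \<in> {i. bit n i}"
    then have "2 ^ i \<le> n"
      by (metis bit_iff_odd div_less even_zero linorder_not_less mem_Collect_eq)
    then show "i \<in> {..<n}"
      using less_le_trans[OF less_exp] by blast
  qed
qed simp

lemma binary_ones_double: "binary_ones (2 * n) = binary_ones n"
proof -
  have "bit (2 * n) i \<longleftrightarrow> i \<in> Suc ` {i. bit n i}" for i
    by (cases i) (auto simp: bit_0 bit_Suc)
  then have "{i. bit (2 * n) i} = Suc ` {i. bit n i}"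
    by blast
  then show ?thesis
    by (simp add: binary_ones_def card_image)
qed

lemma binary_ones_double_add_one: "binary_ones (1 + 2 * n) = Suc (binary_ones n)"
proof -
  have "bit (1 + 2 * n) i \<longleftrightarrow> i = 0 \<or> i \<in> Suc ` {i. bit n i}" for i
    by (cases i) (auto simp: bit_0 bit_Suc)
  then have "{i. bit (1 + 2 * n) i} = insert 0 (Suc ` {i. bit n i})"
    by blast
  then show ?thesis
    by (simp add: binary_ones_def card_image finite_bits_nat)
qed

text \<open>The digits of \<open>a\<close> lie below position \<open>k\<close> and those of
  \<open>2 ^ k * n\<close> from \<open>k\<close> on, so nothing carries. The induction strips the
  lowest digit of \<open>a\<close>.\<close>

lemma binary_ones_append:
  "a < 2 ^ k \<Longrightarrow> binary_ones (a + 2 ^ k * n) = binary_ones a + binary_ones n"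
proof (induction k arbitrary: a)
  case 0
  then show ?case by simp
next
  case (Suc k)
  define c where "c = a div 2"
  have IH: "binary_ones (c + 2 ^ k * n) = binary_ones c + binary_ones n"
    using Suc by (simp add: c_def)
  consider (even) "a = 2 * c" | (odd) "a = 1 + 2 * c"
    unfolding c_def by linarith
  then show ?case
  proof cases
    case even
    have "a + 2 ^ Suc k * n = 2 * (c + 2 ^ k * n)"
      by (simp add: even)
    then show ?thesis
      by (simp only: binary_ones_double IH) (simp only: even binary_ones_double)
  next
    case odd
    have "a + 2 ^ Suc k * n = 1 + 2 * (c + 2 ^ k * n)"
      by (simp add: odd)
    then show ?thesis
      by (simp only: binary_ones_double_add_one IH) (simp only: odd binary_ones_double_add_one add_Suc)
  qed
qed

text \<open>Each of the \<open>k\<close> digits scales the contribution of \<open>y\<close> by 2,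
  and each digit one also by 1/3. Leading zeros of \<open>a\<close> count among the \<open>k\<close>
  digits.\<close>

lemma Phi_append:
  "a < 2 ^ k \<Longrightarrow>
    Phi (of_nat a + 2 ^ k * y) = Phi (of_nat a) + 2 ^ k * inverse 3 ^ binary_ones a * Phi y"
proof (induction k arbitrary: a)
  case 0
  then show ?case by simp
next
  case (Suc k)
  \<comment> \<open>\<open>c\<close> is \<open>a\<close> without its lowest digit; it is below
    \<open>2 ^ k\<close>, so the induction hypothesis applies to it.\<close>
  define c where "c = a div 2"
  have IH: "Phi (of_nat c + 2 ^ k * y) = Phi (of_nat c) + 2 ^ k * inverse 3 ^ binary_ones c * Phi y"
    using Suc by (simp add: c_def)
  consider (even) "a = 2 * c" | (odd) "a = 1 + 2 * c"
    unfolding c_def by linarith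
  then show ?case
  proof cases
    case even
    have "of_nat a + 2 ^ Suc k * y = 2 * (of_nat c + 2 ^ k * y)"
      by (simp add: even algebra_simps)
    moreover have "Phi (of_nat a) = 2 * Phi (of_nat c)"
      using Phi_double[of "of_nat c"] by (simp add: even)
    moreover have "binary_ones a = binary_ones c"
      unfolding even by (rule binary_ones_double)
    ultimately show ?thesis
      by (simp only: Phi_double IH) (simp add: algebra_simps)
  next
    case odd
    have "of_nat a + 2 ^ Suc k * y = 1 + 2 * (of_nat c + 2 ^ k * y)"
      by (simp add: odd algebra_simps)
    moreover have "Phi (of_nat a) = - 1 + 2 * inverse 3 * Phi (of_nat c)"
      using Phi_double_add_one[of "of_nat c"] by (simp add: odd)
    moreover have "binary_ones a = Suc (binary_ones c)"
      unfolding odd by (rule binary_ones_double_add_one)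
    ultimately show ?thesis
      by (simp only: Phi_double_add_one IH) (simp add: algebra_simps)
  qed
qed

section \<open>Repeated blocks, finite and infinite\<close>

lemma repeat_block_Suc: "repeat_block b v (Suc t) = b + 2 ^ v * repeat_block b v t"
  unfolding repeat_block_def sum.lessThan_Suc_shift
  by (simp add: power_add sum_distrib_left algebra_simps)

lemma repeat_block_less:
  assumes "b < 2 ^ v"
  shows "repeat_block b v t < 2 ^ (t * v)"
proof (induction t)
  case 0
  show ?case by (simp add: repeat_block_def)
next
  case (Suc t)
  have "b + 2 ^ v * repeat_block b v t < 2 ^ v * Suc (repeat_block b v t)"
    using assms by simp
  also have "\<dots> \<le> 2 ^ v * 2 ^ (t * v)"
    using Suc by (intro mult_left_mono) auto
  finally show ?case
    by (simp add: repeat_block_Suc power_add)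
qed

lemma binary_ones_repeat_block:
  assumes "b < 2 ^ v"
  shows "binary_ones (repeat_block b v t) = t * binary_ones b"
proof (induction t)
  case 0
  show ?case by (simp add: repeat_block_def)
next
  case (Suc t)
  then show ?case
    using assms by (simp add: repeat_block_Suc binary_ones_append)
qed

lemma repeat_block_inf_unfold:
  assumes "b < 2 ^ v"
  shows "repeat_block_inf b v = of_nat b + 2 ^ v * repeat_block_inf b v"
proof (cases "v = 0")
  \<comment> \<open>Here \<open>b < 2 ^ 0\<close> forces \<open>b = 0\<close>, so the value of the
    divergent series is irrelevant.\<close>
  case True
  then show ?thesis
    using assms by (simp add: repeat_block_inf_def)
next
  case False
  define S :: z2 where "S = (\<Sum>i. 2 ^ (v * i))"
  have "summable (\<lambda>i. 2 ^ (v * i) :: z2)"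
    using summable_z2_powers[of "\<lambda>i. v * i" "\<lambda>_. 1"] False by (simp add: strict_mono_def)
  then have sums: "(\<lambda>i. 2 ^ (v * i)) sums S"
    unfolding S_def by (rule summable_sums)
  \<comment> \<open>Without its first term, the geometric series is \<open>2 ^ v\<close> times
    itself.\<close>
  have "(\<lambda>i. 2 ^ (v * i)) sums (1 + 2 ^ v * S)"
    using sums_z2_shift[OF sums, where g = "\<lambda>i. 2 ^ (v * i)" and d = "2 ^ v"]
    by (simp add: power_add)
  with sums have "S = 1 + 2 ^ v * S"
    by (rule sums_unique2)
  then have "of_nat b * S = of_nat b * (1 + 2 ^ v * S)"
    by (rule arg_cong)
  also have "\<dots> = of_nat b + 2 ^ v * (of_nat b * S)"
    by (simp add: algebra_simps)
  finally show ?thesis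
    unfolding repeat_block_inf_def S_def[symmetric] .
qed

text \<open>Splitting off the lowest block \<open>t\<close> times leaves the same periodic tail each
  time.\<close>

lemma repeat_block_inf_split:
  assumes "b < 2 ^ v"
  shows "repeat_block_inf b v = of_nat (repeat_block b v t) + 2 ^ (t * v) * repeat_block_inf b v"
proof (induction t)
  case 0
  show ?case by (simp add: repeat_block_def)
next
  case (Suc t)
  have "repeat_block_inf b v = of_nat b + 2 ^ v * repeat_block_inf b v"
    using assms by (rule repeat_block_inf_unfold)
  also have "\<dots> = of_nat b + 2 ^ v *
      (of_nat (repeat_block b v t) + 2 ^ (t * v) * repeat_block_inf b v)"
    by (subst Suc) (rule refl)
  also have "\<dots> = of_nat (repeat_block b v (Suc t)) + 2 ^ (Suc t * v) * repeat_block_inf b v"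
    by (simp add: repeat_block_Suc power_add algebra_simps)
  finally show ?case .
qed

text \<open>Turns the division in the theorem into the powers of \<open>inverse 3\<close> that
  \<open>Phi_append\<close> produces.\<close>

lemma inverse_3_power: "inverse (3 ^ n) = (inverse 3 ^ n :: z2)"
  by (rule z2_inverse_eqI) (simp add: z2_three_inverse flip: power_mult_distrib)

theorem theorem13:
  fixes q :: z2 and a k b v m t :: nat
  assumes "q \<in> rationals_z2"
    and "a < 2 ^ k" and "b < 2 ^ v"
    and "q = of_nat a + 2 ^ k * repeat_block_inf b v"
    and "m = binary_ones b"
    and "t > 0"
  shows "Phi (of_nat (a + 2 ^ k * repeat_block b v t)) =
    Phi q - Phi (repeat_block_inf b v) / 3 ^ (m * t + binary_ones a) * 2 ^ (k + t * v)"
proof -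
  \<comment> \<open>\<open>A\<close> consists of the lowest \<open>k + t * v\<close> digits of
    \<open>q\<close>; the bound below lets \<open>Phi_append\<close> cut \<open>q\<close> at that
    position.\<close>
  define A where "A = a + 2 ^ k * repeat_block b v t"
  have "A < 2 ^ k * Suc (repeat_block b v t)"
    using assms(2) by (simp add: A_def)
  also have "\<dots> \<le> 2 ^ k * 2 ^ (t * v)"
    using repeat_block_less[OF assms(3), of t] by (intro mult_left_mono) auto
  finally have A_less: "A < 2 ^ (k + t * v)"
    by (simp add: power_add)
  \<comment> \<open>This is the exponent of 3: each of the \<open>t\<close> blocks contributes
    \<open>m\<close> ones.\<close>
  have ones: "binary_ones A = m * t + binary_ones a"
    using assms by (simp add: A_def binary_ones_append binary_ones_repeat_block)
  have "q = of_nat a + 2 ^ k *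
      (of_nat (repeat_block b v t) + 2 ^ (t * v) * repeat_block_inf b v)"
    unfolding assms(4) by (subst repeat_block_inf_split[OF assms(3), of t]) (rule refl)
  also have "\<dots> = of_nat A + 2 ^ (k + t * v) * repeat_block_inf b v"
    by (simp add: A_def power_add algebra_simps)
  finally have "Phi q = Phi (of_nat A) +
      2 ^ (k + t * v) * inverse 3 ^ (m * t + binary_ones a) * Phi (repeat_block_inf b v)"
    using Phi_append[OF A_less] ones by simp
  \<comment> \<open>Solving for \<open>Phi (of_nat A)\<close> moves the tail term across and gives
    the minus sign.\<close>
  then show ?thesis
    unfolding A_def[symmetric] by (simp add: divide_z2_def inverse_3_power mult_ac)
qed

end
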